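(* Let $\lambda_0\in\mathbb{R}$. If $d$ is a symmetric approximate design with $$\sum_{s\langle\in\rangle{\cal R}}p_{\langle s\rangle}r_s'(x_0)=0,\qquad \sum_{s\langle\in\rangle{\cal R}}p_{\langle s\rangle}=1,\qquad p_s=0\ \text{ if } s\notin{\cal R},$$ where $r_s'$ is the derivative of $r_s$, then for every exchangeable prior distribution $g$ of $\tau_0$, $d$ maximizes $\varphi_{g,\lambda_0}$ over all approximate designs.
   Context: Fix integers $p\ge2$ (periods), $t\ge2$ (treatments), $n\ge1$ (subjects) and a symmetric positive definite real $p\times p$ matrix $\Sigma$ (within-subject covariance). $1_k$ is the all-ones vector of length $k$, $J_k=1_k1_k'$, $B_k=I_k-J_k/k$, prime on matrices denotes transpose, and $\tilde B=\Sigma^{-1}-\Sigma^{-1}J_p\Sigma^{-1}/(1_p'\Sigma^{-1}1_p)$. Let ${\cal S}=\{1,\dots,t\}^p$ be the set of treatment sequences. For $s=(t_1,\dots,t_p)\in{\cal S}$, $T_s$ is the $p\times t$ matrix with $(k,i)$ entry $1$ if $t_k=i$ and $0$ otherwise; $F_s$ is the $p\times t$ matrix with zero first row and, for $k\ge2$, $(k,i)$ entry $1$ if $t_{k-1}=i$ and $0$ otherwise. An (approximate) design $d$ is a vector $P_d=(p_s)_{s\in{\cal S}}$ with $p_s\ge0$, $\sum_sp_s=1$. For a permutation $\sigma$ of $\{1,\dots,t\}$, $\sigma s=(\sigma(t_1),\dots,\sigma(t_p))$; $d$ is symmetric if $p_{\sigma s}=p_s$ for all $\sigma$ and $s$. The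 symmetric block of $s$ is $\langle s\rangle=\{\sigma s:\sigma\text{ a permutation}\}$, and $p_{\langle s\rangle}=\sum_{\tilde s\in\langle s\rangle}p_{\tilde s}$. For $1\le i,j\le2$ put $\hat A_{sij}=B_tG_{s,i}'\tilde BG_{s,j}B_t$ with $G_{s,1}=F_s$, $G_{s,2}=T_s+\lambda_0F_s$; $\hat A_{dij}=n\sum_sp_s\hat A_{sij}$; $A_{dij}=\hat A_{dij}-nG_i'\tilde BG_j$ with $G_1=\sum_sp_sF_sB_t$, $G_2=\sum_sp_s(T_s+\lambda_0F_s)B_t$; and $A_d=A_{d11}-A_{d12}A_{d22}^-A_{d21}$ ($^-$ denotes a generalized inverse); $A_d$ is nonnegative definite. In the proportional model (carryover effects equal $\lambda$ times direct effects $\tau$), the information for $\lambda$ at $(\tau_0,\lambda_0)$ is $\tau_0'A_d\tau_0$. A prior $g$ is a probability distribution on $\{\tau_0\in\mathbb{R}^t:1_t'\tau_0=0,\ \tau_0\neq0\}$, exchangeable if invariant under all permutations of coordinates, and $\varphi_{g,\lambda_0}(d)=\mathbb{E}_g[\tau_0'A_d\tau_0]\in[0,\infty]$. Let $h_{sij}=\mathrm{tr}(\hat A_{sij})$, $r_s(x)=h_{s11}+2h_{s12}x+h_{s22}x^2$ (which depends only on $\langle s\rangle$), $r(x)=\max_{s\in{\cal S}}r_s(x)$, $y_0=\min_{x\in\mathbb{R}}r(x)$; $x_0$ is the solution of $r(x)=y_0$, which is taken (standing assumption) to be unique; ${\cal R}=\{s\in{\cal S}:r_s(x_0)=y_0\}$,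 a union of symmetric blocks. The notation $s\langle\in\rangle{\cal R}$ means that $s$ runs through one representative of each distinct symmetric block contained in ${\cal R}$. *)

theory Defs
  imports "HOL-Probability.Probability"
begin

text \<open>
  Periods are indexed by a finite linearly ordered type \<open>'p\<close> and treatments by a
  finite type \<open>'t\<close>.  A treatment sequence is a function from periods to treatments; a vector
  of sequence weights is a real function on sequences.
\<close>

type_synonym ('p, 't) trt_seq = "'p \<Rightarrow> 't"
type_synonym ('p, 't) weights = "('p \<Rightarrow> 't) \<Rightarrow> real"

text \<open>
  Real matrices with rows indexed by \<open>'m\<close> and columns by \<open>'n\<close>; unlike
  \<open>real^'n^'m\<close>, this form lets an index type carry a sort stronger than
  \<open>finite\<close> without repeating the sort at every occurrence.
\<close>

type_synonym ('m, 'n) rmat = "((real, 'n) vec, 'm) vec"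

definition approx_design :: "('p::finite, 't::finite) weights \<Rightarrow> bool" where
  "approx_design d \<longleftrightarrow> (\<forall>s. 0 \<le> d s) \<and> (\<Sum>s\<in>UNIV. d s) = 1"

definition symmetric_design :: "('p, 't) weights \<Rightarrow> bool" where
  "symmetric_design d \<longleftrightarrow> (\<forall>\<sigma> s. bij \<sigma> \<longrightarrow> d (\<sigma> \<circ> s) = d s)"

definition symm_block :: "('p, 't) trt_seq \<Rightarrow> ('p, 't) trt_seq set" where
  "symm_block s = {\<sigma> \<circ> s | \<sigma>. bij \<sigma>}"

definition block_weight :: "('p, 't) weights \<Rightarrow> ('p, 't) trt_seq \<Rightarrow> real" where
  "block_weight d s = (\<Sum>s'\<in>symm_block s. d s')"

text \<open>\<open>Q\<close> contains exactly one representative of each symmetric block contained in \<open>R\<close>.\<close>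

definition block_representatives ::
    "('p, 't) trt_seq set \<Rightarrow> ('p, 't) trt_seq set \<Rightarrow> bool" where
  "block_representatives R Q \<longleftrightarrow> bij_betw symm_block Q {b \<in> range symm_block. b \<subseteq> R}"

definition pos_def :: "real^'n^'n \<Rightarrow> bool" where
  "pos_def S \<longleftrightarrow> transpose S = S \<and> (\<forall>v. v \<noteq> 0 \<longrightarrow> 0 < v \<bullet> (S *v v))"

definition ginverse :: "real^'m^'n \<Rightarrow> real^'n^'m \<Rightarrow> bool" where
  "ginverse A X \<longleftrightarrow> A ** X ** A = A"

definition ones_vec :: "real^'n" where
  "ones_vec = (\<chi> i. 1)"

definition ones_mat :: "real^'n^'n" where
  "ones_mat = (\<chi> i j. 1)"

definition centering :: "real^'n^'n" where
  "centering = mat 1 - (1 / real CARD('n)) *\<^sub>R ones_mat"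

definition Btilde :: "real^'p^'p \<Rightarrow> real^'p^'p" where
  "Btilde S = matrix_inv S
     - (1 / (ones_vec \<bullet> (matrix_inv S *v ones_vec))) *\<^sub>R
         (matrix_inv S ** ones_mat ** matrix_inv S)"

definition Tmat :: "('p::finite, 't::finite) trt_seq \<Rightarrow> real^'t^'p" where
  "Tmat s = (\<chi> k i. if s k = i then 1 else 0)"

text \<open>\<open>Max {j. j < k}\<close> is the period immediately preceding a non-initial period \<open>k\<close>.\<close>

definition Fmat :: "('p::{finite,linorder}, 't::finite) trt_seq \<Rightarrow> ('p, 't) rmat" where
  "Fmat s = (\<chi> k i. if (\<exists>j. j < k) \<and> s (Max {j. j < k}) = i then 1 else 0)"

text \<open>The indices \<open>i\<close> and \<open>j\<close> below are only ever 1 or 2.\<close>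

definition Gmat :: "real \<Rightarrow> nat \<Rightarrow> ('p::{finite,linorder}, 't::finite) trt_seq \<Rightarrow> ('p, 't) rmat" where
  "Gmat lam i s = (if i = 1 then Fmat s else Tmat s + lam *\<^sub>R Fmat s)"

definition Ahat_seq ::
    "('p, 'p) rmat \<Rightarrow> real \<Rightarrow> nat \<Rightarrow> nat \<Rightarrow> ('p::{finite,linorder}, 't::finite) trt_seq \<Rightarrow> real^'t^'t" where
  "Ahat_seq S lam i j s =
     centering ** transpose (Gmat lam i s) ** Btilde S ** Gmat lam j s ** centering"

definition Ahat_design ::
    "nat \<Rightarrow> ('p, 'p) rmat \<Rightarrow> real \<Rightarrow> ('p::{finite,linorder}, 't::finite) weights
      \<Rightarrow> nat \<Rightarrow> nat \<Rightarrow> real^'t^'t" where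
  "Ahat_design n S lam d i j = real n *\<^sub>R (\<Sum>s\<in>UNIV. d s *\<^sub>R Ahat_seq S lam i j s)"

definition Gbar ::
    "real \<Rightarrow> ('p::{finite,linorder}, 't::finite) weights \<Rightarrow> nat \<Rightarrow> ('p, 't) rmat" where
  "Gbar lam d i = (\<Sum>s\<in>UNIV. d s *\<^sub>R (Gmat lam i s ** centering))"

definition A_block ::
    "nat \<Rightarrow> ('p, 'p) rmat \<Rightarrow> real \<Rightarrow> ('p::{finite,linorder}, 't::finite) weights
      \<Rightarrow> nat \<Rightarrow> nat \<Rightarrow> real^'t^'t" where
  "A_block n S lam d i j =
     Ahat_design n S lam d i j
       - real n *\<^sub>R (transpose (Gbar lam d i) ** Btilde S ** Gbar lam d j)"

text \<open>\<open>ginv\<close> is the chosen generalized-inverse operation.\<close>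

definition A_info ::
    "(real^'t^'t \<Rightarrow> real^'t^'t) \<Rightarrow> nat \<Rightarrow> ('p, 'p) rmat \<Rightarrow> real
      \<Rightarrow> ('p::{finite,linorder}, 't::finite) weights \<Rightarrow> real^'t^'t" where
  "A_info ginv n S lam d =
     A_block n S lam d 1 1
       - A_block n S lam d 1 2 ** ginv (A_block n S lam d 2 2) ** A_block n S lam d 2 1"

definition prior :: "(real^'t) measure \<Rightarrow> bool" where
  "prior g \<longleftrightarrow> prob_space g \<and> sets g = sets borel \<and>
     (AE \<tau> in g. ones_vec \<bullet> \<tau> = 0 \<and> \<tau> \<noteq> 0)"

definition exchangeable :: "(real^'t) measure \<Rightarrow> bool" where
  "exchangeable g \<longleftrightarrow> (\<forall>\<sigma>. bij \<sigma> \<longrightarrow> distr g borel (\<lambda>\<tau>. \<chi> i. \<tau> $ \<sigma> i) = g)"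

text \<open>
  The integrand is nonnegative because \<open>A_info\<close> is nonnegative definite, so the coercion
  to \<open>ennreal\<close> does not truncate anything; the expectation may be infinite.
\<close>

definition phi ::
    "(real^'t^'t \<Rightarrow> real^'t^'t) \<Rightarrow> nat \<Rightarrow> ('p, 'p) rmat \<Rightarrow> (real^'t) measure \<Rightarrow> real
      \<Rightarrow> ('p::{finite,linorder}, 't::finite) weights \<Rightarrow> ennreal" where
  "phi ginv n S g lam d = (\<integral>\<^sup>+ \<tau>. ennreal (\<tau> \<bullet> (A_info ginv n S lam d *v \<tau>)) \<partial>g)"

definition h_seq ::
    "('p, 'p) rmat \<Rightarrow> real \<Rightarrow> nat \<Rightarrow> nat \<Rightarrow> ('p::{finite,linorder}, 't::finite) trt_seq \<Rightarrow> real" where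
  "h_seq S lam i j s = trace (Ahat_seq S lam i j s)"

definition r_seq ::
    "('p, 'p) rmat \<Rightarrow> real \<Rightarrow> ('p::{finite,linorder}, 't::finite) trt_seq \<Rightarrow> real \<Rightarrow> real" where
  "r_seq S lam s x = h_seq S lam 1 1 s + 2 * h_seq S lam 1 2 s * x + h_seq S lam 2 2 s * x^2"

text \<open>
  The treatment type does not occur in the types of \<open>S\<close>, \<open>lam\<close> and \<open>x\<close>, hence the
  \<open>itself\<close> argument.
\<close>

definition r_max ::
    "'t::finite itself \<Rightarrow> ('p::{finite,linorder}, 'p) rmat \<Rightarrow> real \<Rightarrow> real \<Rightarrow> real" where
  "r_max T S lam x = Max (range (\<lambda>s::('p, 't) trt_seq. r_seq S lam s x))"

text \<open>Each \<open>r_seq S lam s\<close> is nonnegative when \<open>S\<close> is positive definite, so the infimum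
  is over a set bounded below.  The minimum is attained exactly when \<open>r_max T S lam x\<close>
  equals \<open>y_min T S lam\<close> for some \<open>x\<close>.\<close>

definition y_min :: "'t::finite itself \<Rightarrow> ('p::{finite,linorder}, 'p) rmat \<Rightarrow> real \<Rightarrow> real" where
  "y_min T S lam = (INF x. r_max T S lam x)"

definition R_set ::
    "('p, 'p) rmat \<Rightarrow> real \<Rightarrow> real \<Rightarrow> ('p::{finite,linorder}, 't::finite) trt_seq set" where
  "R_set S lam x0 = {s. r_seq S lam s x0 = y_min TYPE('t) S lam}"

end

(*
  Minimizing over w in the quadratic form of the block matrix (A_dij) at (tau, w) gives
  tau' A_d tau; the choice w = x0 tau, after dropping the mean correction, bounds it by
  tau' K_d tau with K_d = Ahat_d11 + 2 x0 Ahat_d12 + x0^2 Ahat_d22.  Under an exchangeable prior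
  K_d may be replaced by its average over permutations, tr(K_d)/(t-1) B_t, and
  tr(K_d) = n sum_s p_s r_s(x0) <= n y0.  For a symmetric design the means G_i vanish and every
  A_dij is a multiple c_ij of B_t, so w = x0 tau is optimal exactly when c_12 + c_22 x0 = 0, which
  is the stationarity hypothesis; as d lives on R, both inequalities are then equalities.  Second
  moments of the prior may be infinite, so permutations are averaged inside the integral.
*)
theory Submission
  imports Defs
begin

subsection \<open>Schur complements with an arbitrary generalized inverse\<close>

text \<open>Split \<open>u\<close> into a part \<open>y\<close> in the range of \<open>C\<close> and
  a part \<open>z\<close> orthogonal to it. Symmetry puts \<open>z\<close> into the kernel, so the
  hypothesis makes \<open>u\<close> orthogonal to \<open>z\<close>; since \<open>y\<close> is
  orthogonal to \<open>z\<close> too, \<open>z\<close> is orthogonal to itself.\<close>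

lemma symmetric_range:
  fixes C :: "real^'n^'n"
  assumes sym: "transpose C = C" and u: "\<And>z. C *v z = 0 \<Longrightarrow> u \<bullet> z = 0"
  obtains w where "C *v w = u"
proof -
  have sp: "span (range ((*v) C)) = range ((*v) C)"
    by (simp add: span_eq_iff linear_subspace_image)
  obtain y z where yz: "y \<in> span (range ((*v) C))" 
     "\<And>w. w \<in> span (range ((*v) C)) \<Longrightarrow> orthogonal z w" "u = y + z"
    using orthogonal_subspace_decomp_exists[of "range ((*v) C)" u] by metis
  have "(C *v z) \<bullet> v = 0" for v
  proof -
    have "z \<bullet> (C *v v) = 0"
      using yz(2)[of "C *v v"] by (auto simp: orthogonal_def intro: span_base)
    then show ?thesis by (metis dot_lmul_matrix sym transpose_matrix_vector)
  qed
  then have "C *v z = 0" by (metis inner_eq_zero_iff)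
  then have "u \<bullet> z = 0" by (rule u)
  moreover have "y \<bullet> z = 0" using yz(1,2) by (simp add: orthogonal_def inner_commute)
  ultimately have "z = 0" using yz(3) by (simp add: inner_add_left)
  with yz sp that show ?thesis by auto
qed

text \<open>Nonnegativity of the joint form forces the transpose of \<open>B\<close> to map
  \<open>u\<close> into the range of \<open>C\<close>, say to \<open>C *v w\<close>. The correction
  term then equals \<open>w \<bullet> (C *v w)\<close> whatever generalized inverse is chosen, and
  the gap between the two sides is the form of \<open>C\<close> at \<open>v + w\<close>.\<close>

lemma schur_complement_le:
  fixes A :: "real^'m^'m" and B :: "real^'n^'m" and C :: "real^'n^'n"
  assumes sym: "transpose C = C"
    and psd: "\<And>u v. 0 \<le> u \<bullet> (A *v u) + 2 * (u \<bullet> (B *v v)) + v \<bullet> (C *v v)"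
    and X: "ginverse C X"
  shows "u \<bullet> ((A - B ** X ** transpose B) *v u)
           \<le> u \<bullet> (A *v u) + 2 * (u \<bullet> (B *v v)) + v \<bullet> (C *v v)"
proof -
  have adj: "a \<bullet> (C *v b) = (C *v a) \<bullet> b" for a b
    by (metis dot_lmul_matrix sym transpose_matrix_vector)
  have adjB: "a \<bullet> (B *v b) = (transpose B *v a) \<bullet> b" for a b
    by (metis dot_lmul_matrix transpose_matrix_vector)
  have "(transpose B *v u) \<bullet> z = 0" if z: "C *v z = 0" for z
  proof (rule ccontr)
    let ?a = "u \<bullet> (A *v u)" and ?b = "u \<bullet> (B *v z)"
    assume "(transpose B *v u) \<bullet> z \<noteq> 0"
    then have b: "?b \<noteq> 0" by (simp add: adjB)
    have "0 \<le> ?a + 2 * (u \<bullet> (B *v (k *\<^sub>R z))) + (k *\<^sub>R z) \<bullet> (C *v (k *\<^sub>R z))" for k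
      by (rule psd)
    then have "0 \<le> ?a + 2 * (k * ?b)" for k
      by (simp add: matrix_vector_mult_scaleR z)
    \<comment> \<open>Since \<open>z\<close> lies in the kernel, the joint form at multiples of
      \<open>z\<close> is affine in \<open>k\<close>; this \<open>k\<close> gives it the value
      -1.\<close>
    from this[of "- (?a + 1) / (2 * ?b)"] psd[of u 0] b show False
      by (simp add: field_simps)
  qed
  then obtain w where w: "C *v w = transpose B *v u"
    using symmetric_range[OF sym] by metis
  have "u \<bullet> ((B ** X ** transpose B) *v u) = (C *v w) \<bullet> (X *v (C *v w))"
    by (simp add: adjB w flip: matrix_vector_mul_assoc)
  also have "\<dots> = w \<bullet> ((C ** X ** C) *v w)"
    by (simp add: adj flip: matrix_vector_mul_assoc)
  also have "\<dots> = w \<bullet> (C *v w)" using X by (simp add: ginverse_def)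
  finally have e: "u \<bullet> ((B ** X ** transpose B) *v u) = w \<bullet> (C *v w)" .
  \<comment> \<open>Completing the square: the joint form with first argument 0 shows that
    \<open>C\<close> itself is nonnegative definite.\<close>
  have "0 \<le> (v + w) \<bullet> (C *v (v + w))" using psd[of 0 "v + w"] by simp
  also have "\<dots> = v \<bullet> (C *v v) + 2 * (v \<bullet> (C *v w)) + w \<bullet> (C *v w)"
    using adj[of v w] by (simp add: matrix_vector_right_distrib inner_add_left inner_add_right inner_commute)
  also have "v \<bullet> (C *v w) = u \<bullet> (B *v v)" by (simp add: w adjB inner_commute)
  finally show ?thesis using e
    by (simp add: matrix_vector_mult_diff_rdistrib inner_diff_right)
qed

subsection \<open>Permutation-invariant matrices\<close>

lemma sum_centering: "(\<Sum>j\<in>UNIV. (centering :: real^'n^'n) $ i $ j) = 0"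
  by (simp add: centering_def mat_def ones_mat_def sum_subtractf)

lemma transpose_centering: "transpose (centering :: real^'n^'n) = centering"
  by (simp add: centering_def vec_eq_iff mat_def ones_mat_def transpose_def)

lemma matrix_mul_centering_nth:
  fixes M :: "real^'n^'m"
  shows "(M ** centering) $ k $ a = M $ k $ a - (\<Sum>b\<in>UNIV. M $ k $ b) / real CARD('n)"
proof -
  have "(M ** centering) $ k $ a =
      (\<Sum>b\<in>UNIV. (if b = a then M $ k $ b else 0) - M $ k $ b / real CARD('n))"
    unfolding matrix_matrix_mult_def centering_def
    by (simp add: mat_def ones_mat_def algebra_simps, intro sum.cong)
      (auto simp: algebra_simps)
  then show ?thesis by (simp add: sum_subtractf sum_divide_distrib)
qed

lemma sum_matrix_mul_centering:
  fixes M :: "real^'n^'m"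
  shows "(\<Sum>a\<in>UNIV. (M ** centering) $ k $ a) = 0"
  by (simp add: matrix_mul_centering_nth sum_subtractf)

lemma centering_idem: "(centering :: real^'n^'n) ** centering = centering"
  by (simp add: vec_eq_iff matrix_mul_centering_nth sum_centering)

lemma centering_nonneg: "0 \<le> v \<bullet> ((centering :: real^'n^'n) *v v)"
proof -
  have "v \<bullet> (centering *v v) = v \<bullet> (transpose centering *v (centering *v v))"
    by (simp add: transpose_centering matrix_vector_mul_assoc centering_idem)
  also have "\<dots> = (centering *v v) \<bullet> (centering *v v)"
    by (metis dot_lmul_matrix transpose_matrix_vector transpose_transpose)
  finally show ?thesis by simp
qed

text \<open>Transpositions make the diagonal constant and the off-diagonal entries of each row
  equal; the zero row sum ties the latter to the former. One free parameter remains, and the trace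
  determines it because \<open>centering\<close> has trace one less than the dimension.\<close>

lemma perm_invariant_eq_centering:
  fixes M :: "real^'n^'n"
  assumes card: "2 \<le> CARD('n)"
    and inv: "\<And>\<sigma> i j. bij \<sigma> \<Longrightarrow> M $ \<sigma> i $ \<sigma> j = M $ i $ j"
    and row: "\<And>i. (\<Sum>j\<in>UNIV. M $ i $ j) = 0"
  shows "M = (trace M / (real CARD('n) - 1)) *\<^sub>R centering"
proof -
  have diag: "M $ i $ i = M $ j $ j" for i j
    using inv[of "Transposition.transpose i j" i i] by simp
  have off: "M $ i $ j = M $ i $ l" if "i \<noteq> j" "i \<noteq> l" for i j l
    using inv[of "Transposition.transpose j l" i j] that by simp
  have card_off: "real (CARD('n) - 1) = real CARD('n) - 1" using card by (simp add: of_nat_diff)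
  have offdiag: "(real CARD('n) - 1) * M $ i $ j = - M $ i $ i" if "i \<noteq> j" for i j
  proof -
    have "(\<Sum>l\<in>UNIV. M $ i $ l) = M $ i $ i + (\<Sum>l\<in>UNIV - {i}. M $ i $ l)"
      by (rule sum.remove) auto
    also have "(\<Sum>l\<in>UNIV - {i}. M $ i $ l) = (\<Sum>l\<in>UNIV - {i}. M $ i $ j)"
      by (rule sum.cong[OF refl], rule off) (use that in auto)
    finally show ?thesis using row[of i] card_off by (simp add: card_Diff_singleton)
  qed
  have tr: "trace M = real CARD('n) * M $ i $ i" for i
  proof -
    have "trace M = (\<Sum>j\<in>(UNIV :: 'n set). M $ i $ i)"
      unfolding trace_def by (intro sum.cong diag refl)
    then show ?thesis by simp
  qed
  have "M $ i $ j = trace M / (real CARD('n) - 1) * (centering :: real^'n^'n) $ i $ j" for i j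
  proof (cases "i = j")
    case True
    then show ?thesis using tr[of i] card
      by (simp add: centering_def mat_def ones_mat_def field_simps)
  next
    case False
    have "trace M = - real CARD('n) * ((real CARD('n) - 1) * M $ i $ j)"
      using False tr[of i] offdiag[of i j] by simp
    then show ?thesis using False card
      by (simp add: centering_def mat_def ones_mat_def field_simps)
  qed
  then show ?thesis by (simp add: vec_eq_iff)
qed

text \<open>Summing \<open>K\<close> over all simultaneous permutations of rows and columns gives an
  invariant matrix \<open>M\<close> with zero row sums, hence a multiple of
  \<open>centering\<close>. Everything stays in nonnegative integrals, so infinite second moments do
  no harm; nonnegativity of \<open>K\<close> lets the finite sum pass through
  \<open>ennreal\<close>.\<close>

lemma exchangeable_nn_integral:
  fixes g :: "(real^'n) measure" and K :: "real^'n^'n"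
  assumes card: "2 \<le> CARD('n)" and sets: "sets g = sets borel" and ex: "exchangeable g"
    and psd: "\<And>v. 0 \<le> v \<bullet> (K *v v)"
    and row: "\<And>i. (\<Sum>j\<in>UNIV. K $ i $ j) = 0"
  shows "(\<integral>\<^sup>+ v. ennreal (v \<bullet> (K *v v)) \<partial>g)
       = (\<integral>\<^sup>+ v. ennreal (trace K / (real CARD('n) - 1) * (v \<bullet> (centering *v v))) \<partial>g)"
proof -
  define P where "P \<sigma> = (\<lambda>v :: real^'n. \<chi> i. v $ \<sigma> i)" for \<sigma> :: "'n \<Rightarrow> 'n"
  define Perm where "Perm = {\<sigma> :: 'n \<Rightarrow> 'n. bij \<sigma>}"
  define M :: "real^'n^'n" where "M = (\<chi> i j. \<Sum>\<sigma>\<in>Perm. K $ \<sigma> i $ \<sigma> j)"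
  have finP: "finite Perm" by simp
  have Pne: "Perm \<noteq> {}" using bij_id by (auto simp: Perm_def)
  have quad: "v \<bullet> (L *v v) = (\<Sum>i\<in>UNIV. \<Sum>j\<in>UNIV. L $ i $ j * v $ i * v $ j)"
    for v and L :: "real^'n^'n"
    by (simp add: inner_vec_def matrix_vector_mult_def sum_distrib_left mult_ac)
  have contP: "continuous_on UNIV (P \<sigma>)" for \<sigma>
    unfolding P_def by (intro continuous_intros)
  have mP: "P \<sigma> \<in> borel_measurable g" for \<sigma>
    using borel_measurable_continuous_onI[OF contP] sets
    by (metis measurable_cong_sets)
  have contK: "continuous_on UNIV (\<lambda>v. v \<bullet> (L *v v))" for L :: "real^'n^'n"
    by (intro continuous_intros linear_continuous_on) (simp add: linear_linear)
  have mK: "(\<lambda>v. ennreal (v \<bullet> (L *v v))) \<in> borel_measurable borel" for L :: "real^'n^'n"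
    using borel_measurable_continuous_onI[OF contK] by measurable
  have inv1: "(\<integral>\<^sup>+ v. ennreal (v \<bullet> (K *v v)) \<partial>g) = (\<integral>\<^sup>+ v. ennreal (P \<sigma> v \<bullet> (K *v P \<sigma> v)) \<partial>g)"
    if "bij \<sigma>" for \<sigma>
  proof -
    have "distr g borel (P \<sigma>) = g" using ex that by (simp add: exchangeable_def P_def)
    then have "(\<integral>\<^sup>+ v. ennreal (v \<bullet> (K *v v)) \<partial>g) = (\<integral>\<^sup>+ v. ennreal (v \<bullet> (K *v v)) \<partial>distr g borel (P \<sigma>))"
      by simp
    also have "\<dots> = (\<integral>\<^sup>+ v. ennreal (P \<sigma> v \<bullet> (K *v P \<sigma> v)) \<partial>g)"
      by (rule nn_integral_distr[OF mP]) (simp add: mK)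
    finally show ?thesis .
  qed
  have M_inv: "M $ \<tau> i $ \<tau> j = M $ i $ j" if "bij \<tau>" for \<tau> i j
  proof -
    \<comment> \<open>Right composition with a fixed permutation is a bijection of the permutation
      group.\<close>
    have "(\<Sum>\<sigma>\<in>Perm. K $ \<sigma> (\<tau> i) $ \<sigma> (\<tau> j)) = (\<Sum>\<sigma>\<in>Perm. K $ \<sigma> i $ \<sigma> j)"
      by (rule sum.reindex_bij_witness[of _ "\<lambda>\<sigma>. \<sigma> \<circ> inv \<tau>" "\<lambda>\<sigma>. \<sigma> \<circ> \<tau>"])
        (use that in \<open>auto simp: Perm_def fun_eq_iff bij_is_surj bij_is_inj surj_f_inv_f inv_f_f
            intro: bij_comp bij_imp_bij_inv\<close>)
    then show ?thesis by (simp add: M_def)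
  qed
  have M_row: "(\<Sum>j\<in>UNIV. M $ i $ j) = 0" for i
  proof -
    have "(\<Sum>j\<in>UNIV. M $ i $ j) = (\<Sum>\<sigma>\<in>Perm. \<Sum>j\<in>UNIV. K $ \<sigma> i $ \<sigma> j)"
      by (simp add: M_def sum.swap[of _ _ Perm])
    also have "\<dots> = (\<Sum>\<sigma>\<in>Perm. \<Sum>j\<in>UNIV. K $ \<sigma> i $ j)"
      by (intro sum.cong refl sum.reindex_bij_betw[where g = "\<lambda>j. K $ _ $ j"]) (simp add: Perm_def)
    finally show ?thesis by (simp add: row)
  qed
  have M_trace: "trace M = real (card Perm) * trace K"
  proof -
    have "trace M = (\<Sum>\<sigma>\<in>Perm. \<Sum>i\<in>UNIV. K $ \<sigma> i $ \<sigma> i)"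
      by (simp add: M_def trace_def sum.swap[of _ _ Perm])
    also have "\<dots> = (\<Sum>\<sigma>\<in>Perm. trace K)"
      unfolding trace_def
      by (intro sum.cong refl sum.reindex_bij_betw[where g = "\<lambda>j. K $ j $ j"]) (simp add: Perm_def)
    finally show ?thesis by simp
  qed
  \<comment> \<open>Moving the permutation from the vector to the matrix indices inverts it; in the
    sum over the whole group the inverse is then removed by reindexing.\<close>
  have Pquad: "P \<sigma> v \<bullet> (K *v P \<sigma> v)
      = (\<Sum>i\<in>UNIV. \<Sum>j\<in>UNIV. K $ inv \<sigma> i $ inv \<sigma> j * v $ i * v $ j)" if "bij \<sigma>" for \<sigma> v
  proof -
    have r: "(\<Sum>j\<in>UNIV. f (\<sigma> j)) = (\<Sum>j\<in>UNIV. f j)" for f :: "'n \<Rightarrow> real"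
      by (rule sum.reindex_bij_betw[OF that])
    have i: "inv \<sigma> (\<sigma> j) = j" for j using that by (simp add: bij_is_inj)
    show ?thesis unfolding quad P_def
      by (subst r[symmetric], subst (2) r[symmetric]) (simp add: i)
  qed
  have sum_quad: "(\<Sum>\<sigma>\<in>Perm. P \<sigma> v \<bullet> (K *v P \<sigma> v)) = v \<bullet> (M *v v)" for v
  proof -
    have "(\<Sum>\<sigma>\<in>Perm. P \<sigma> v \<bullet> (K *v P \<sigma> v)) =
        (\<Sum>\<sigma>\<in>Perm. \<Sum>i\<in>UNIV. \<Sum>j\<in>UNIV. K $ inv \<sigma> i $ inv \<sigma> j * v $ i * v $ j)"
      by (intro sum.cong) (auto simp: Perm_def Pquad)
    also have "\<dots> = (\<Sum>\<sigma>\<in>Perm. \<Sum>i\<in>UNIV. \<Sum>j\<in>UNIV. K $ \<sigma> i $ \<sigma> j * v $ i * v $ j)"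
      by (rule sum.reindex_bij_witness[of _ inv inv])
        (auto simp: Perm_def inv_inv_eq intro: bij_imp_bij_inv)
    also have "\<dots> = (\<Sum>i\<in>UNIV. \<Sum>j\<in>UNIV. \<Sum>\<sigma>\<in>Perm. K $ \<sigma> i $ \<sigma> j * v $ i * v $ j)"
      by (simp only: sum.swap[of _ _ Perm])
    finally show ?thesis by (simp add: quad M_def sum_distrib_right)
  qed
  \<comment> \<open>By exchangeability every permuted integral equals the original one, so their sum
    is \<open>card Perm\<close> copies of it. This factor is finite and nonzero and is cancelled at
    the end.\<close>
  have "of_nat (card Perm) * (\<integral>\<^sup>+ v. ennreal (v \<bullet> (K *v v)) \<partial>g)
      = (\<Sum>\<sigma>\<in>Perm. \<integral>\<^sup>+ v. ennreal (P \<sigma> v \<bullet> (K *v P \<sigma> v)) \<partial>g)"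
    by (subst sum.cong[OF refl inv1[symmetric]]) (simp_all add: Perm_def)
  also have "\<dots> = (\<integral>\<^sup>+ v. (\<Sum>\<sigma>\<in>Perm. ennreal (P \<sigma> v \<bullet> (K *v P \<sigma> v))) \<partial>g)"
    by (rule nn_integral_sum[symmetric]) (use measurable_compose[OF mP mK] in simp)
  also have "\<dots> = (\<integral>\<^sup>+ v. ennreal (v \<bullet> (M *v v)) \<partial>g)"
    by (simp add: sum_ennreal psd flip: sum_quad)
  also have "\<dots> = (\<integral>\<^sup>+ v. ennreal (real (card Perm) * (trace K / (real CARD('n) - 1) * (v \<bullet> (centering *v v)))) \<partial>g)"
    by (subst perm_invariant_eq_centering[OF card M_inv M_row])
      (simp_all add: M_trace mult_ac flip: scaleR_matrix_vector_assoc)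
  also have "\<dots> = (\<integral>\<^sup>+ v. of_nat (card Perm) * ennreal (trace K / (real CARD('n) - 1) * (v \<bullet> (centering *v v))) \<partial>g)"
    by (intro nn_integral_cong) (simp only: ennreal_mult'[OF of_nat_0_le_iff] ennreal_of_nat_eq_real_of_nat)
  also have "\<dots> = of_nat (card Perm) * (\<integral>\<^sup>+ v. ennreal (trace K / (real CARD('n) - 1) * (v \<bullet> (centering *v v))) \<partial>g)"
  proof (rule nn_integral_cmult)
    have "(\<lambda>v :: real^'n. trace K / (real CARD('n) - 1) * (v \<bullet> (centering *v v))) \<in> borel_measurable borel"
      by (intro borel_measurable_continuous_onI continuous_on_mult_left contK)
    then have "(\<lambda>v :: real^'n. ennreal (trace K / (real CARD('n) - 1) * (v \<bullet> (centering *v v)))) \<in> borel_measurable borel"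
      by (rule measurable_compose) simp
    then show "(\<lambda>v. ennreal (trace K / (real CARD('n) - 1) * (v \<bullet> (centering *v v)))) \<in> borel_measurable g"
      using measurable_cong_sets[OF sets refl] by blast
  qed
  finally show ?thesis
    using finP Pne by (simp add: ennreal_mult_cancel_left)
qed

subsection \<open>Information matrices of designs\<close>

lemma inner_vector_matrix_mult:
  fixes A :: "real^'n^'m"
  shows "u \<bullet> (v v* A) = (A *v u) \<bullet> v"
  by (metis dot_lmul_matrix inner_commute)

text \<open>\<open>matrix_inv\<close> is defined by choice, so a two-sided inverse has to be
  produced first, from the trivial kernel. Symmetry then follows from uniqueness of inverses, and
  nonnegativity by evaluating the form of \<open>S\<close> at the image of \<open>v\<close> under
  the inverse.\<close>

lemma pos_def_inverse:
  fixes S :: "real^'n^'n"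
  assumes "pos_def S"
  shows "transpose (matrix_inv S) = matrix_inv S" and "0 \<le> v \<bullet> (matrix_inv S *v v)"
proof -
  define V where "V = matrix_inv S"
  have sym: "transpose S = S" and pos: "\<And>v. v \<noteq> 0 \<Longrightarrow> 0 < v \<bullet> (S *v v)"
    using assms by (auto simp: pos_def_def)
  have "S *v x = 0 \<Longrightarrow> x = 0" for x using pos[of x] by force
  then have "\<exists>V. V ** S = mat 1" by (simp add: matrix_left_invertible_ker)
  then have "\<exists>V. S ** V = mat 1 \<and> V ** S = mat 1" by (metis matrix_left_right_inverse)
  then have V: "S ** V = mat 1" "V ** S = mat 1"
    unfolding V_def matrix_inv_def by (metis (mono_tags, lifting) someI_ex)+
  have "transpose V ** S = mat 1" by (metis V(1) matrix_transpose_mul sym transpose_mat)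
  then show "transpose (matrix_inv S) = matrix_inv S"
    by (metis V(1) V_def matrix_mul_assoc matrix_mul_lid matrix_mul_rid)
  have "v \<bullet> (V *v v) = (V *v v) \<bullet> (S *v (V *v v))"
    by (simp add: matrix_vector_mul_assoc V inner_commute)
  then show "0 \<le> v \<bullet> (matrix_inv S *v v)"
    using pos[of "V *v v"] by (cases "V *v v = 0") (auto simp: V_def)
qed

section \<open>The bilinear form of \<open>Btilde\<close>\<close>

lemma ones_mat_mult_vec: "ones_mat *v (w :: real^'n) = (ones_vec \<bullet> w) *\<^sub>R ones_vec"
  by (simp add: vec_eq_iff ones_mat_def ones_vec_def matrix_vector_mult_def inner_vec_def)

lemma Btilde_inner:
  fixes S :: "real^'n^'n"
  shows "u \<bullet> (Btilde S *v v) = u \<bullet> (matrix_inv S *v v)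
    - (ones_vec \<bullet> (matrix_inv S *v v)) * (u \<bullet> (matrix_inv S *v ones_vec))
        / (ones_vec \<bullet> (matrix_inv S *v ones_vec))"
  by (simp add: Btilde_def matrix_vector_mult_diff_rdistrib inner_diff_right matrix_scaleR_vector_ac
      ones_mat_mult_vec flip: scaleR_matrix_vector_assoc matrix_vector_mul_assoc)

lemma Btilde_sym:
  fixes S :: "real^'n^'n"
  assumes "pos_def S"
  shows "u \<bullet> (Btilde S *v v) = v \<bullet> (Btilde S *v u)"
proof -
  have "a \<bullet> (matrix_inv S *v b) = b \<bullet> (matrix_inv S *v a)" for a b
    by (metis pos_def_inverse(1)[OF assms] inner_vector_matrix_mult inner_commute transpose_matrix_vector)
  then show ?thesis unfolding Btilde_inner by (simp add: mult.commute)
qed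

text \<open>The form of \<open>Btilde S\<close> is that of \<open>matrix_inv S\<close> at the component of \<open>v\<close>
  orthogonal, for the latter form, to the vector of ones.\<close>

lemma Btilde_nonneg:
  fixes S :: "real^'n^'n"
  assumes "pos_def S"
  shows "0 \<le> v \<bullet> (Btilde S *v v)"
proof -
  define V where "V = matrix_inv S"
  have sym: "a \<bullet> (V *v b) = b \<bullet> (V *v a)" for a b
    unfolding V_def by (metis pos_def_inverse(1)[OF assms] inner_vector_matrix_mult inner_commute transpose_matrix_vector)
  define q where "q = ones_vec \<bullet> (V *v ones_vec)"
  define p where "p = ones_vec \<bullet> (V *v v)"
  have "0 \<le> (v - (p / q) *\<^sub>R ones_vec) \<bullet> (V *v (v - (p / q) *\<^sub>R ones_vec))"
    unfolding V_def by (rule pos_def_inverse(2)[OF assms])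
  also have "\<dots> = v \<bullet> (V *v v) - 2 * (p / q) * p + (p / q)^2 * q"
    using sym[of v ones_vec]
    by (simp add: matrix_vector_mult_diff_distrib matrix_scaleR_vector_ac inner_diff_left
        inner_diff_right power2_eq_square flip: p_def q_def scaleR_matrix_vector_assoc)
  \<comment> \<open>This identity covers \<open>q = 0\<close> as well, where both quotients are 0 by
    convention.\<close>
  also have "\<dots> = v \<bullet> (V *v v) - p * p / q"
    by (simp add: power2_eq_square)
  also have "\<dots> = v \<bullet> (Btilde S *v v)"
    using sym[of v ones_vec] by (simp add: Btilde_inner p_def q_def V_def)
  finally show ?thesis .
qed

text \<open>Absorbing the centering makes \<open>Ahat_seq\<close> a Gram product of two
  \<open>Hmat\<close> factors with respect to \<open>Btilde S\<close>, and \<open>Gbar\<close> the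
  weighted mean of the \<open>Hmat\<close> matrices.\<close>

definition Hmat :: "real \<Rightarrow> nat \<Rightarrow> ('p::{finite,linorder}, 't::finite) trt_seq \<Rightarrow> ('p, 't) rmat" where
  "Hmat lam i s = Gmat lam i s ** centering"

lemma Ahat_seq_inner:
  "u \<bullet> (Ahat_seq S lam i j s *v v) = (Hmat lam i s *v u) \<bullet> (Btilde S *v (Hmat lam j s *v v))"
proof -
  have "Ahat_seq S lam i j s = transpose (Hmat lam i s) ** (Btilde S ** Hmat lam j s)"
    by (simp add: Ahat_seq_def Hmat_def matrix_transpose_mul transpose_centering matrix_mul_assoc)
  then show ?thesis by (simp add: inner_vector_matrix_mult flip: matrix_vector_mul_assoc)
qed

section \<open>Quadratic forms of the design blocks\<close>

lemma sum_matrix_vector_mult: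
  fixes M :: "'a \<Rightarrow> real^'n^'m"
  shows "(\<Sum>s\<in>A. M s) *v v = (\<Sum>s\<in>A. M s *v v)"
  by (induction A rule: infinite_finite_induct) (simp_all add: matrix_vector_mult_add_rdistrib)

lemma matrix_vector_mult_sum:
  fixes M :: "real^'n^'m"
  shows "M *v (\<Sum>s\<in>A. f s) = (\<Sum>s\<in>A. M *v f s)"
  by (induction A rule: infinite_finite_induct) (simp_all add: matrix_vector_right_distrib)

lemma Ahat_design_inner:
  "u \<bullet> (Ahat_design n S lam d i j *v v) =
     real n * (\<Sum>s\<in>UNIV. d s * ((Hmat lam i s *v u) \<bullet> (Btilde S *v (Hmat lam j s *v v))))"
  by (simp add: Ahat_design_def sum_matrix_vector_mult inner_sum_right Ahat_seq_inner
      flip: scaleR_matrix_vector_assoc)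

lemma Gbar_mult_vec: "Gbar lam d i *v u = (\<Sum>s\<in>UNIV. d s *\<^sub>R (Hmat lam i s *v u))"
  by (simp add: Gbar_def sum_matrix_vector_mult flip: scaleR_matrix_vector_assoc Hmat_def)

lemma A_block_inner:
  "u \<bullet> (A_block n S lam d i j *v v) = u \<bullet> (Ahat_design n S lam d i j *v v)
     - real n * ((Gbar lam d i *v u) \<bullet> (Btilde S *v (Gbar lam d j *v v)))"
  by (simp add: A_block_def matrix_vector_mult_diff_rdistrib inner_diff_right inner_vector_matrix_mult
      flip: scaleR_matrix_vector_assoc matrix_vector_mul_assoc)

lemma transpose_eqI:
  fixes X :: "real^'n^'m"
  assumes "\<And>u v. u \<bullet> (X *v v) = v \<bullet> (Y *v u)"
  shows "transpose X = Y"
proof -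
  have "v \<bullet> (transpose X *v u) = v \<bullet> (Y *v u)" for u v
    by (simp add: inner_vector_matrix_mult inner_commute flip: assms)
  then show ?thesis by (metis matrix_eq vector_eq_ldot)
qed

lemma transpose_A_block:
  assumes "pos_def S"
  shows "transpose (A_block n S lam d i j) = A_block n S lam d j i"
  by (rule transpose_eqI) (simp add: A_block_inner Ahat_design_inner Btilde_sym[OF assms])

text \<open>Centering at the design mean exhibits the block matrix of the \<open>A_block\<close>s as a Gram matrix.\<close>

lemma A_block_centered:
  assumes "approx_design d"
  shows "u \<bullet> (A_block n S lam d i j *v v) =
    real n * (\<Sum>s\<in>UNIV. d s * (((Hmat lam i s - Gbar lam d i) *v u)
       \<bullet> (Btilde S *v ((Hmat lam j s - Gbar lam d j) *v v))))"
proof -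
  define a where "a s = Hmat lam i s *v u" for s :: "('a, 'b) trt_seq"
  define b where "b s = Btilde S *v (Hmat lam j s *v v)" for s :: "('a, 'b) trt_seq"
  define ma where "ma = Gbar lam d i *v u"
  define mb where "mb = Btilde S *v (Gbar lam d j *v v)"
  have ma: "ma = (\<Sum>s\<in>UNIV. d s *\<^sub>R a s)" by (simp add: ma_def a_def Gbar_mult_vec)
  have mb: "mb = (\<Sum>s\<in>UNIV. d s *\<^sub>R b s)"
    by (simp add: mb_def b_def Gbar_mult_vec matrix_vector_mult_sum matrix_scaleR_vector_ac
        flip: scaleR_matrix_vector_assoc)
  have one: "(\<Sum>s\<in>UNIV. d s) = 1" using assms by (simp add: approx_design_def)
  have "(\<Sum>s\<in>UNIV. d s * ((a s - ma) \<bullet> (b s - mb)))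
      = (\<Sum>s\<in>UNIV. d s * (a s \<bullet> b s)) - (\<Sum>s\<in>UNIV. d s *\<^sub>R a s) \<bullet> mb
        - ma \<bullet> (\<Sum>s\<in>UNIV. d s *\<^sub>R b s) + (\<Sum>s\<in>UNIV. d s) * (ma \<bullet> mb)"
    by (simp add: inner_sum_left inner_sum_right inner_diff_left inner_diff_right algebra_simps
        sum.distrib sum_subtractf sum_distrib_left sum_distrib_right)
  \<comment> \<open>As the weights sum to one, the three terms containing a mean collapse to one
    subtracted product.\<close>
  also have "\<dots> = (\<Sum>s\<in>UNIV. d s * (a s \<bullet> b s)) - ma \<bullet> mb"
    by (simp add: one flip: ma mb)
  finally show ?thesis
    by (simp add: A_block_inner Ahat_design_inner matrix_vector_mult_diff_rdistrib
        matrix_vector_mult_diff_distrib a_def b_def ma_def mb_def right_diff_distrib)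
qed

text \<open>The quadratic form is that of the block matrix of the \<open>Ahat_design\<close> blocks
  at the pair of \<open>u\<close> and \<open>x *\<^sub>R u\<close>. Both cross terms are merged into
  the (1,2) block, so the matrix may fail to be symmetric while its quadratic form is the intended
  one.\<close>

definition Kmat ::
    "nat \<Rightarrow> ('p, 'p) rmat \<Rightarrow> real \<Rightarrow> ('p::{finite,linorder}, 't::finite) weights
      \<Rightarrow> real \<Rightarrow> real^'t^'t" where
  "Kmat n S lam d x = Ahat_design n S lam d 1 1 + (2 * x) *\<^sub>R Ahat_design n S lam d 1 2
     + x^2 *\<^sub>R Ahat_design n S lam d 2 2"

lemma Kmat_inner:
  "u \<bullet> (Kmat n S lam d x *v u) = u \<bullet> (Ahat_design n S lam d 1 1 *v u)
     + 2 * x * (u \<bullet> (Ahat_design n S lam d 1 2 *v u)) + x^2 * (u \<bullet> (Ahat_design n S lam d 2 2 *v u))"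
  by (simp add: Kmat_def matrix_vector_mult_add_rdistrib inner_add_right
      flip: scaleR_matrix_vector_assoc)

lemma Btilde_square:
  assumes "pos_def S"
  shows "(a + b) \<bullet> (Btilde S *v (a + b))
    = a \<bullet> (Btilde S *v a) + 2 * (a \<bullet> (Btilde S *v b)) + b \<bullet> (Btilde S *v b)"
  using Btilde_sym[OF assms, of b a]
  by (simp add: matrix_vector_right_distrib inner_add_left inner_add_right)

text \<open>The form is a nonnegatively weighted sum of \<open>Btilde\<close> forms at the
  combinations \<open>w s\<close>. This is the nonnegativity that averaging over an exchangeable
  prior requires.\<close>

lemma Kmat_nonneg:
  assumes "pos_def S" and "approx_design d"
  shows "0 \<le> u \<bullet> (Kmat n S lam d x *v u)"
proof -
  define w where "w s = Hmat lam 1 s *v u + x *\<^sub>R (Hmat lam 2 s *v u)" for s :: "('a, 'b) trt_seq"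
  have "u \<bullet> (Kmat n S lam d x *v u) = real n * (\<Sum>s\<in>UNIV. d s * (w s \<bullet> (Btilde S *v w s)))"
    unfolding Kmat_inner Ahat_design_inner w_def Btilde_square[OF assms(1)]
    by (simp add: matrix_scaleR_vector_ac sum.distrib sum_distrib_left algebra_simps power2_eq_square
        flip: scaleR_matrix_vector_assoc)
  also have "\<dots> \<ge> 0" using assms
    by (auto intro!: mult_nonneg_nonneg sum_nonneg Btilde_nonneg simp: approx_design_def)
  finally show ?thesis .
qed

text \<open>The Schur complement bound is taken at \<open>v = x *\<^sub>R u\<close>; the joint form
  of the blocks is nonnegative because, after centering at the design mean, it is a weighted sum of
  \<open>Btilde\<close> forms.\<close>

lemma A_info_le_Kmat:
  assumes S: "pos_def S" and d: "approx_design d"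
    and ginv: "\<And>A. ginverse A (ginv A)"
  shows "u \<bullet> (A_info ginv n S lam d *v u) \<le> u \<bullet> (Kmat n S lam d x *v u)"
proof -
  let ?A = "A_block n S lam d"
  have psd: "0 \<le> u \<bullet> (?A 1 1 *v u) + 2 * (u \<bullet> (?A 1 2 *v v)) + v \<bullet> (?A 2 2 *v v)" for u v
  proof -
    define w1 where "w1 s = (Hmat lam 1 s - Gbar lam d 1) *v u" for s
    define w2 where "w2 s = (Hmat lam 2 s - Gbar lam d 2) *v v" for s
    have "u \<bullet> (?A 1 1 *v u) + 2 * (u \<bullet> (?A 1 2 *v v)) + v \<bullet> (?A 2 2 *v v)
        = real n * (\<Sum>s\<in>UNIV. d s * ((w1 s + w2 s) \<bullet> (Btilde S *v (w1 s + w2 s))))"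
      unfolding A_block_centered[OF d] Btilde_square[OF S] w1_def[symmetric] w2_def[symmetric]
      by (simp add: sum.distrib sum_distrib_left algebra_simps)
    also have "\<dots> \<ge> 0" using d
      by (auto intro!: mult_nonneg_nonneg sum_nonneg Btilde_nonneg[OF S] simp: approx_design_def)
    finally show ?thesis .
  qed
  define g where "g i = Gbar lam d i *v u" for i
  have "A_info ginv n S lam d = ?A 1 1 - ?A 1 2 ** ginv (?A 2 2) ** transpose (?A 1 2)"
    by (simp add: A_info_def transpose_A_block[OF S])
  then have "u \<bullet> (A_info ginv n S lam d *v u)
      \<le> u \<bullet> (?A 1 1 *v u) + 2 * (u \<bullet> (?A 1 2 *v (x *\<^sub>R u))) + (x *\<^sub>R u) \<bullet> (?A 2 2 *v (x *\<^sub>R u))"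
    using schur_complement_le[OF transpose_A_block[OF S] psd ginv, of u "x *\<^sub>R u"] by (simp only:)
  also have "\<dots> = u \<bullet> (Kmat n S lam d x *v u)
      - real n * ((g 1 + x *\<^sub>R g 2) \<bullet> (Btilde S *v (g 1 + x *\<^sub>R g 2)))"
    unfolding Kmat_inner Btilde_square[OF S]
    by (simp add: matrix_scaleR_vector_ac A_block_inner g_def algebra_simps power2_eq_square
        flip: scaleR_matrix_vector_assoc)
  also have "\<dots> \<le> u \<bullet> (Kmat n S lam d x *v u)"
    using Btilde_nonneg[OF S] by simp
  finally show ?thesis .
qed

section \<open>Traces and row sums of the averaged matrices\<close>

lemma trace_sum: "trace (\<Sum>s\<in>A. M s) = (\<Sum>s\<in>A. trace (M s))"
  unfolding trace_def by (simp add: sum.swap[of _ _ A])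

lemma trace_scaleR: "trace (c *\<^sub>R M) = c * trace (M :: real^'n^'n)"
  by (simp add: trace_def sum_distrib_left)

lemma trace_Ahat_design:
  "trace (Ahat_design n S lam d i j) = real n * (\<Sum>s\<in>UNIV. d s * h_seq S lam i j s)"
  by (simp add: Ahat_design_def trace_sum trace_scaleR h_seq_def)

lemma trace_Kmat:
  "trace (Kmat n S lam d x) = real n * (\<Sum>s\<in>UNIV. d s * r_seq S lam s x)"
  by (simp add: Kmat_def trace_add trace_scaleR trace_Ahat_design r_seq_def sum.distrib
      sum_distrib_left algebra_simps)

lemma Ahat_seq_row: "(\<Sum>b\<in>UNIV. Ahat_seq S lam i j s $ a $ b) = 0"
  unfolding Ahat_seq_def by (rule sum_matrix_mul_centering)

lemma Ahat_design_row: "(\<Sum>b\<in>UNIV. Ahat_design n S lam d i j $ a $ b) = 0"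
proof -
  have "(\<Sum>b\<in>UNIV. Ahat_design n S lam d i j $ a $ b)
      = real n * (\<Sum>s\<in>UNIV. d s * (\<Sum>b\<in>UNIV. Ahat_seq S lam i j s $ a $ b))"
    by (simp add: Ahat_design_def sum_distrib_left) (rule sum.swap)
  then show ?thesis by (simp add: Ahat_seq_row)
qed

lemma Kmat_row: "(\<Sum>b\<in>UNIV. Kmat n S lam d x $ a $ b) = 0"
  by (simp add: Kmat_def sum.distrib Ahat_design_row flip: sum_distrib_left)

subsection \<open>Relabelling the treatments\<close>

text \<open>Relabelling treatments permutes the columns of \<open>Gmat\<close>, and the row mean
  that centering subtracts does not depend on the order of the columns.\<close>

lemma Hmat_perm:
  fixes \<sigma> :: "'t::finite \<Rightarrow> 't"
  assumes "bij \<sigma>"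
  shows "Hmat lam i (\<sigma> \<circ> s) $ k $ \<sigma> a = Hmat lam i s $ k $ a"
proof -
  have inj: "\<sigma> x = \<sigma> y \<longleftrightarrow> x = y" for x y using assms by (metis bij_is_inj injD)
  have G: "Gmat lam i (\<sigma> \<circ> s) $ k $ \<sigma> a = Gmat lam i s $ k $ a" for a
    by (simp add: Gmat_def Tmat_def Fmat_def inj)
  have "(\<Sum>b\<in>UNIV. Gmat lam i (\<sigma> \<circ> s) $ k $ b) = (\<Sum>b\<in>UNIV. Gmat lam i s $ k $ b)"
    using sum.reindex_bij_betw[OF assms, of "\<lambda>b. Gmat lam i (\<sigma> \<circ> s) $ k $ b"] by (simp add: G)
  then show ?thesis by (simp add: Hmat_def matrix_mul_centering_nth G)
qed

lemma matrix_nth_inner: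
  fixes A :: "real^'n^'m"
  shows "A $ a $ b = axis a 1 \<bullet> (A *v axis b 1)"
  by (simp add: inner_axis inner_axis' matrix_vector_mul_component)

text \<open>An entry is the bilinear form at two basis vectors, and it depends on these only through
  their images under \<open>Hmat\<close>, which relabelling preserves.\<close>

lemma Ahat_seq_perm:
  fixes \<sigma> :: "'t::finite \<Rightarrow> 't"
  assumes "bij \<sigma>"
  shows "Ahat_seq S lam i j (\<sigma> \<circ> s) $ \<sigma> a $ \<sigma> b = Ahat_seq S lam i j s $ a $ b"
proof -
  have "Hmat lam i (\<sigma> \<circ> s) *v axis (\<sigma> a) 1 = Hmat lam i s *v axis a 1" for i a
    by (simp add: vec_eq_iff Hmat_perm[OF assms] matrix_vector_mult_basis column_def)
  then show ?thesis by (simp add: matrix_nth_inner Ahat_seq_inner)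
qed

lemma h_seq_perm:
  fixes \<sigma> :: "'t::finite \<Rightarrow> 't"
  assumes "bij \<sigma>"
  shows "h_seq S lam i j (\<sigma> \<circ> s) = h_seq S lam i j s"
  unfolding h_seq_def trace_def
  using sum.reindex_bij_betw[OF assms, of "\<lambda>b. Ahat_seq S lam i j (\<sigma> \<circ> s) $ b $ b"]
  by (simp add: Ahat_seq_perm[OF assms])

lemma r_seq_perm:
  fixes \<sigma> :: "'t::finite \<Rightarrow> 't"
  assumes "bij \<sigma>"
  shows "r_seq S lam (\<sigma> \<circ> s) = r_seq S lam s"
  by (simp add: r_seq_def fun_eq_iff h_seq_perm[OF assms])

section \<open>Information matrices of symmetric designs\<close>

lemma bij_comp_left: 
  assumes "bij \<sigma>"
  shows "bij (\<lambda>s :: 'a \<Rightarrow> 'b. \<sigma> \<circ> s)"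
  by (rule o_bij[where g = "\<lambda>s. inv \<sigma> \<circ> s"])
    (use assms in \<open>auto simp: fun_eq_iff bij_is_surj bij_is_inj surj_f_inv_f\<close>)

lemma sum_symmetric_design:
  fixes d :: "('p::finite, 't::finite) weights"
  assumes "symmetric_design d" and "bij \<sigma>"
  shows "(\<Sum>s\<in>UNIV. d s *\<^sub>R f s) = (\<Sum>s\<in>UNIV. d s *\<^sub>R f (\<sigma> \<circ> s))"
  using sum.reindex_bij_betw[OF bij_comp_left[OF assms(2)], of "\<lambda>s. d s *\<^sub>R f s"] assms
  by (simp add: symmetric_design_def)

lemma Ahat_symmetric_design:
  fixes d :: "('p::{finite,linorder}, 't::finite) weights"
  assumes "2 \<le> CARD('t)" and d: "symmetric_design d"
  shows "Ahat_design n S lam d i j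
    = (trace (Ahat_design n S lam d i j) / (real CARD('t) - 1)) *\<^sub>R centering"
proof (rule perm_invariant_eq_centering[OF assms(1) _ Ahat_design_row])
  fix \<sigma> :: "'t \<Rightarrow> 't" and a b
  assume "bij \<sigma>"
  then show "Ahat_design n S lam d i j $ \<sigma> a $ \<sigma> b = Ahat_design n S lam d i j $ a $ b"
    using sum_symmetric_design[OF d, of \<sigma> "\<lambda>s. Ahat_seq S lam i j s $ \<sigma> a $ \<sigma> b"]
    by (simp add: Ahat_design_def Ahat_seq_perm)
qed

text \<open>Transpositions make all entries of a row equal, while centering makes each row sum to
  zero.\<close>

lemma Gbar_symmetric_design:
  fixes d :: "('p::{finite,linorder}, 't::finite) weights"
  assumes d: "symmetric_design d"
  shows "Gbar lam d i = 0"
proof -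
  have nth: "Gbar lam d i $ k $ a = (\<Sum>s\<in>UNIV. d s *\<^sub>R (Hmat lam i s $ k $ a))" for k a
    by (simp add: Gbar_def Hmat_def)
  have eq: "Gbar lam d i $ k $ b = Gbar lam d i $ k $ a" for k a b
    using sum_symmetric_design[OF d, of "Transposition.transpose a b" "\<lambda>s. Hmat lam i s $ k $ b"]
      Hmat_perm[of "Transposition.transpose a b" lam i _ k a]
    by (simp add: nth)
  have "(\<Sum>b\<in>UNIV. Gbar lam d i $ k $ b) = 0" for k
    by (simp add: nth sum.swap[of _ "UNIV :: ('p \<Rightarrow> 't) set"] Hmat_def sum_matrix_mul_centering
        flip: sum_distrib_left)
  moreover have "(\<Sum>b\<in>UNIV. Gbar lam d i $ k $ b) = (\<Sum>b\<in>(UNIV :: 't set). Gbar lam d i $ k $ a)" for k a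
    by (intro sum.cong eq refl)
  ultimately show ?thesis by (simp add: vec_eq_iff)
qed

text \<open>All blocks are multiples \<open>c i j\<close> of \<open>centering\<close>, and
  stationarity reads \<open>c 1 2 = - x * c 2 2\<close>. Both outer factors of the correction term
  are therefore \<open>- x\<close> times the (2,2) block, and the defining identity of the
  generalized inverse evaluates the product even when \<open>c 2 2 = 0\<close>.\<close>

lemma A_info_symmetric_design:
  fixes d :: "('p::{finite,linorder}, 't::finite) weights"
  assumes card: "2 \<le> CARD('t)" and S: "pos_def S" and d: "symmetric_design d"
    and ginv: "\<And>A. ginverse A (ginv A)"
    and x: "(\<Sum>s\<in>UNIV. d s * (h_seq S lam 1 2 s + h_seq S lam 2 2 s * x)) = 0"
  shows "A_info ginv n S lam d = (trace (Kmat n S lam d x) / (real CARD('t) - 1)) *\<^sub>R centering"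
proof -
  define c where "c i j = trace (Ahat_design n S lam d i j) / (real CARD('t) - 1)" for i j
  let ?X = "ginv (c 2 2 *\<^sub>R centering)"
  have A: "A_block n S lam d i j = c i j *\<^sub>R centering" for i j
    using Ahat_symmetric_design[OF card d]
    by (simp add: A_block_def Gbar_symmetric_design[OF d] c_def)
  have "trace (Ahat_design n S lam d 1 2) = - x * trace (Ahat_design n S lam d 2 2)"
  proof -
    have "real n * (\<Sum>s\<in>UNIV. d s * (h_seq S lam 1 2 s + h_seq S lam 2 2 s * x)) = 0"
      using x by simp
    then show ?thesis
      by (simp add: trace_Ahat_design algebra_simps sum.distrib sum_distrib_left
          sum_negf eq_neg_iff_add_eq_0)
  qed
  then have c12: "c 1 2 = - x * c 2 2" by (simp add: c_def)
  have scale: "(k *\<^sub>R M) ** ?X ** (k *\<^sub>R M) = k^2 *\<^sub>R (M ** ?X ** M)" for k M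
    by (simp add: matrix_scalar_ac power2_eq_square flip: scalar_matrix_assoc)
  \<comment> \<open>The two off-diagonal blocks are transposes of each other, and a multiple of
    \<open>centering\<close> is symmetric.\<close>
  have "A_block n S lam d 2 1 = A_block n S lam d 1 2"
    unfolding transpose_A_block[OF S, of n lam d 1 2, symmetric]
    by (simp only: A transpose_scalar transpose_centering)
  with A c12 have "A_info ginv n S lam d = c 1 1 *\<^sub>R centering
      - ((- x * c 2 2) *\<^sub>R centering) ** ?X ** ((- x * c 2 2) *\<^sub>R centering)"
    by (metis A_info_def)
  also have "\<dots> = c 1 1 *\<^sub>R centering
      - x^2 *\<^sub>R ((c 2 2 *\<^sub>R centering) ** ?X ** (c 2 2 *\<^sub>R centering))"
    using scale[of "- x" "c 2 2 *\<^sub>R centering"] by (simp only: scaleR_scaleR power2_minus)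
  also have "\<dots> = (c 1 1 + 2 * x * c 1 2 + x^2 * c 2 2) *\<^sub>R centering"
  proof -
    \<comment> \<open>Stationarity turns the cross term into minus twice the square term; so the
      Schur complement attains the bound given by \<open>Kmat\<close>.\<close>
    have "c 1 1 + 2 * x * c 1 2 + x^2 * c 2 2 = c 1 1 - x^2 * c 2 2"
      unfolding c12 by (simp add: power2_eq_square)
    moreover have "(c 2 2 *\<^sub>R centering) ** ?X ** (c 2 2 *\<^sub>R centering) = c 2 2 *\<^sub>R centering"
      using ginv by (simp add: ginverse_def)
    ultimately show ?thesis by (simp only: scaleR_left_diff_distrib scaleR_scaleR)
  qed
  also have "c 1 1 + 2 * x * c 1 2 + x^2 * c 2 2 = trace (Kmat n S lam d x) / (real CARD('t) - 1)"
    by (simp add: c_def Kmat_def trace_add trace_scaleR add_divide_distrib)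
  finally show ?thesis .
qed

section \<open>Symmetric blocks as orbits, and sums over their representatives\<close>

lemma symm_block_eq_iff:
  fixes s s' :: "('p, 't) trt_seq"
  shows "symm_block s = symm_block s' \<longleftrightarrow> s \<in> symm_block s'"
proof
  assume "symm_block s = symm_block s'"
  moreover have "s \<in> symm_block s" unfolding symm_block_def by (auto intro!: exI[of _ id])
  ultimately show "s \<in> symm_block s'" by simp
next
  have sub: "symm_block a \<subseteq> symm_block b" if "a \<in> symm_block b" for a b :: "('p, 't) trt_seq"
    using that unfolding symm_block_def by (force simp: comp_assoc[symmetric] intro: bij_comp)
  assume s: "s \<in> symm_block s'"
  then obtain \<sigma> where "bij \<sigma>" "s = \<sigma> \<circ> s'" by (auto simp: symm_block_def)
  then have "s' = inv \<sigma> \<circ> s" "bij (inv \<sigma>)"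
    by (simp_all add: fun_eq_iff bij_is_inj bij_imp_bij_inv)
  then have "s' \<in> symm_block s" by (auto simp: symm_block_def)
  with s show "symm_block s = symm_block s'" by (intro equalityI sub)
qed

text \<open>Distinct blocks are disjoint orbits, those of the representatives cover
  \<open>R\<close>, and \<open>f\<close> is constant on each, so it factors out of the sum over a
  block.\<close>

lemma sum_block_representatives:
  fixes d f :: "('p::finite, 't::finite) weights"
  assumes Q: "block_representatives R Q"
    and R: "\<And>s. s \<in> R \<Longrightarrow> symm_block s \<subseteq> R"
    and f: "\<And>\<sigma> s. bij \<sigma> \<Longrightarrow> f (\<sigma> \<circ> s) = f s"
  shows "(\<Sum>s\<in>Q. block_weight d s * f s) = (\<Sum>s\<in>R. d s * f s)"
proof -
  have self: "s \<in> symm_block s" for s :: "('p, 't) trt_seq"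
    using symm_block_eq_iff by blast
  have inj: "inj_on symm_block Q" and img: "symm_block ` Q = {b \<in> range symm_block. b \<subseteq> R}"
    using Q by (auto simp: block_representatives_def bij_betw_def)
  have "(\<Union>s\<in>Q. symm_block s) = R"
  proof (intro equalityI subsetI)
    fix x assume "x \<in> (\<Union>s\<in>Q. symm_block s)"
    then show "x \<in> R" using img by blast
  next
    fix x assume "x \<in> R"
    then have "symm_block x \<in> symm_block ` Q" unfolding img using R by blast
    then show "x \<in> (\<Union>s\<in>Q. symm_block s)" using self[of x] by auto
  qed
  then have "(\<Sum>s\<in>R. d s * f s) = (\<Sum>s\<in>Q. \<Sum>s'\<in>symm_block s. d s' * f s')"
    using sum.UNION_disjoint[of Q symm_block "\<lambda>s. d s * f s"] inj
    by (metis (mono_tags, lifting) disjoint_iff finite inj_onD symm_block_eq_iff)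
  also have "\<dots> = (\<Sum>s\<in>Q. \<Sum>s'\<in>symm_block s. d s' * f s)"
    by (intro sum.cong refl) (auto simp: symm_block_def f)
  finally show ?thesis by (simp add: block_weight_def sum_distrib_right)
qed

lemma deriv_r_seq: "deriv (r_seq S lam s) x = 2 * (h_seq S lam 1 2 s + h_seq S lam 2 2 s * x)"
  unfolding r_seq_def by (rule DERIV_imp_deriv) (auto intro!: derivative_eq_intros)

theorem corollary5:
  fixes S :: "('p::{finite,linorder}, 'p) rmat"
    and n :: nat
    and lam0 x0 :: real
    and ginv :: "real^'t^'t \<Rightarrow> real^'t^'t"
    and d :: "('p, 't) weights"
    and Q :: "('p, 't) trt_seq set"
    and g :: "(real^'t) measure"
  assumes "2 \<le> CARD('p)" and "2 \<le> CARD('t)" and "1 \<le> n"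
    and "pos_def S"
    and "\<And>A. ginverse A (ginv A)"
    and x0: "\<And>x. r_max TYPE('t) S lam0 x = y_min TYPE('t) S lam0 \<longleftrightarrow> x = x0"
    and "approx_design d" and "symmetric_design d"
    and "block_representatives (R_set S lam0 x0) Q"
    and "(\<Sum>s\<in>Q. block_weight d s * deriv (r_seq S lam0 s) x0) = 0"
    and "(\<Sum>s\<in>Q. block_weight d s) = 1"
    and "\<And>s. s \<notin> R_set S lam0 x0 \<Longrightarrow> d s = 0"
    and "prior g" and "exchangeable g"
  shows "\<forall>d' :: ('p, 't) weights. approx_design d' \<longrightarrow>
           phi ginv n S g lam0 d' \<le> phi ginv n S g lam0 d"
proof (intro allI impI)
  fix d' :: "('p, 't) weights"
  assume d': "approx_design d'"
  let ?y = "y_min TYPE('t) S lam0" and ?t = "real CARD('t) - 1"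
  note card = \<open>2 \<le> CARD('t)\<close> and S = \<open>pos_def S\<close> and ginv = \<open>\<And>A. ginverse A (ginv A)\<close>
    and d = \<open>approx_design d\<close> and symm = \<open>symmetric_design d\<close>
    and off = \<open>\<And>s. s \<notin> R_set S lam0 x0 \<Longrightarrow> d s = 0\<close>
  \<comment> \<open>The hypothesis on \<open>x0\<close>, read at \<open>x0\<close> itself, says that
    the minimum is attained there.\<close>
  have r_le: "r_seq S lam0 s x0 \<le> ?y" for s :: "('p, 't) trt_seq"
  proof -
    have "r_seq S lam0 s x0 \<le> r_max TYPE('t) S lam0 x0"
      unfolding r_max_def by (rule Max_ge) auto
    then show ?thesis using x0[of x0] by simp
  qed
  have "(\<Sum>s\<in>UNIV. d' s * r_seq S lam0 s x0) \<le> (\<Sum>s\<in>UNIV. d' s * ?y)"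
    using d' r_le by (intro sum_mono mult_left_mono) (auto simp: approx_design_def)
  also have "\<dots> = ?y" using d' by (simp add: approx_design_def flip: sum_distrib_right)
  finally have tr': "trace (Kmat n S lam0 d' x0) \<le> real n * ?y"
    by (simp add: trace_Kmat mult_left_mono)
  \<comment> \<open>On \<open>R_set\<close> the two summands agree by definition; elsewhere the
    weight vanishes. Hence \<open>d\<close> attains the trace bound that holds for every
    competitor.\<close>
  have "(\<Sum>s\<in>UNIV. d s * r_seq S lam0 s x0) = (\<Sum>s\<in>UNIV. d s * ?y)"
    using off by (intro sum.cong) (auto simp: R_set_def)
  then have tr: "trace (Kmat n S lam0 d x0) = real n * ?y"
    using d by (simp add: trace_Kmat approx_design_def flip: sum_distrib_right)
  \<comment> \<open>Invariance of \<open>r_seq\<close> under relabelling makes \<open>R_set\<close>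
    a union of blocks and the derivative constant on each block.\<close>
  have "(\<Sum>s\<in>Q. block_weight d s * deriv (r_seq S lam0 s) x0)
      = (\<Sum>s\<in>R_set S lam0 x0. d s * deriv (r_seq S lam0 s) x0)"
    by (rule sum_block_representatives[OF \<open>block_representatives (R_set S lam0 x0) Q\<close>])
      (auto simp: R_set_def symm_block_def r_seq_perm)
  also have "\<dots> = (\<Sum>s\<in>UNIV. d s * deriv (r_seq S lam0 s) x0)"
    by (rule sum.mono_neutral_left) (auto simp: off)
  also have "\<dots> = 2 * (\<Sum>s\<in>UNIV. d s * (h_seq S lam0 1 2 s + h_seq S lam0 2 2 s * x0))"
    by (simp add: deriv_r_seq sum_distrib_left algebra_simps)
  finally have stat: "(\<Sum>s\<in>UNIV. d s * (h_seq S lam0 1 2 s + h_seq S lam0 2 2 s * x0)) = 0"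
    using \<open>(\<Sum>s\<in>Q. block_weight d s * deriv (r_seq S lam0 s) x0) = 0\<close> by simp
  have "phi ginv n S g lam0 d' \<le> (\<integral>\<^sup>+ v. ennreal (v \<bullet> (Kmat n S lam0 d' x0 *v v)) \<partial>g)"
    unfolding phi_def by (intro nn_integral_mono ennreal_leI A_info_le_Kmat S d' ginv)
  also have "\<dots> = (\<integral>\<^sup>+ v. ennreal (trace (Kmat n S lam0 d' x0) / ?t * (v \<bullet> (centering *v v))) \<partial>g)"
    using \<open>prior g\<close>
    by (intro exchangeable_nn_integral card \<open>exchangeable g\<close> Kmat_nonneg S d' Kmat_row)
      (simp add: prior_def)
  \<comment> \<open>After averaging, the competitor enters only through its trace, so the trace
    bound can be used pointwise under the integral, even if the integral is infinite.\<close>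
  also have "\<dots> \<le> (\<integral>\<^sup>+ v. ennreal (real n * ?y / ?t * (v \<bullet> (centering *v v))) \<partial>g)"
    using card tr'
    by (intro nn_integral_mono ennreal_leI mult_right_mono divide_right_mono centering_nonneg) auto
  also have "\<dots> = phi ginv n S g lam0 d"
    unfolding phi_def A_info_symmetric_design[OF card S symm ginv stat] tr
    by (simp flip: scaleR_matrix_vector_assoc)
  finally show "phi ginv n S g lam0 d' \<le> phi ginv n S g lam0 d" .
qed

end
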